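(* Fix $m,p\in\mathbb{N}=\{1,2,\dots\}$ and define, for $n\in\mathbb{N}_0=\{0,1,2,\dots\}$, $$a_n=\left\lfloor \frac{n\,\phi_{mp}}{p}\right\rfloor,\qquad b_n=\left\lfloor \frac{n(\phi_{mp}+mp)}{p}\right\rfloor,\qquad\text{where }\ \phi_k=\frac{2-k+\sqrt{k^2+4}}{2}.$$ Then: (i) the set of $P$-positions of $m$-Wythoff $p$-Blocking Nim is $\{\{a_i,b_i\}\mid i\in\mathbb{N}_0\}$; (ii)(a) the set of $P$-positions of $m$-Wythoff Modulo-$p$ Nim equals $\{\{a_i,b_i\}\mid i\in\mathbb{N}_0\}$ if and only if $\gcd(m,p)=1$; (ii)(b) the set of $P$-positions of the game $m\mathcal{W}^{(m,mp)}$ is $\{\{a_i,b_i\}\mid i\in\mathbb{N}_0\}$; (iii)(a) for each integer $0\le l<p$, the set of $P$-positions of $l$-Shifted $m\times p$-Wythoff Nim is $\{(a_{ip+l},b_{ip+l})\mid i\in\mathbb{N}_0\}\cup\{(b_{ip-l},a_{ip-l})\mid i\in\mathbb{N}\}$; (iii)(b) the set of $P$-positions of $m\times p$-Wythoff Nim is $\{\{a_i,b_i\}\mid i\in\mathbb{N}_0\}$.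
   Context: All games are impartial two-player games played with a single piece (the Queen) on positions $(x,y)\in\mathbb{N}_0\times\mathbb{N}_0$; players alternate moves, and a player who cannot move loses (the player who makes the last move wins). A $P$-position is one from which the previous player (the one who just moved) can force a win; the set of $P$-positions is the solution. The notation $\{x,y\}$ means both $(x,y)$ and $(y,x)$. Move types. A rook move decreases exactly one coordinate by a positive amount. For integers $q\ge1$ and $0\le l\le q$, an $(l,q)$-rook makes a rook move whose length is $iq+j>0$ for some $i\in\mathbb{N}_0$, $j\in\{0,\dots,l-1\}$; for $l=0$ (called a $q$-rook) the length must be a positive multiple of $q$. For $k\in\mathbb{N}$, a $k$-bishop move is $(x,y)\to(x',y')$ with $0\le x'\le x$, $0\le y'\le y$, $(x',y')\ne(x,y)$ and $|(x-x')-(y-y')|<k$. In $k$-Wythoff Nim the Queen moves as a $k$-bishop or a rook. A roob-type option (relative to $m$) is a rook-type option that is not an $m$-bishop option. Games. (i) $m$-Wythoff $p$-Blocking Nim: the Queen moves as an $m$-bishop or a rook, but before the next player moves, the previous player may declare at most $p-1$ of the next player's roob-type options forbidden for that move only (blocking is forgotten after the move). (ii) For $0\le l\le q$, the game $m\mathcal{W}^{(l,q)}$: the Queen moves as an $m$-bishop or an $(l,q)$-rook. $m$-Wythoff Modulo-$p$ Nim is $m\mathcal{W}^{(0,p)}$, i.e. moves are $m$-bishop moves or $p$-rook moves. (iii)(a) For $0\le l<p$, $l$-Shifted $m\times p$-Wythoff Nim: the Queen moves as in $(mp)$-Wythoff Nim, except that if $l>0$ it may not move to (and the board does not contain) any position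 $(i,j)$ with $0\le i<ml$ and $0\le j<m(p-l)$; so for $l>0$ the terminal positions are $(ml,0)$ and $(0,m(p-l))$. For $l=0$ it is $(mp)$-Wythoff Nim. (iii)(b) $m\times p$-Wythoff Nim: before the first player moves, the second player chooses $l\in\{0,\dots,p-1\}$; thereafter the game is played with the rules of $l$-Shifted $m\times p$-Wythoff Nim.
   Formalization: In (iii)(a) the coordinates of the printed set are exchanged, since as printed it fails (m=1, p=3, l=1: (0,1) is off the board); in (iii)(b) the second player may only choose l for which the starting position is on the l-shifted board. *)

theory Defs
  imports Complex_Main
begin

type_synonym pos = "nat \<times> nat"

text \<open>
  Winning positions of a two-player game in which, before each move from a state \<open>s\<close>, the previous
  player picks a declaration \<open>d \<in> decl s\<close>; the next player must then move to a state in
  \<open>moves s d\<close>, and loses if there is none. Games without declarations are the case of a single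
  trivial declaration. As least fixed points, the two predicates say that the previous, respectively
  the next, player can force a win in finitely many moves.
\<close>

inductive prev_wins :: "('s \<Rightarrow> 'd set) \<Rightarrow> ('s \<Rightarrow> 'd \<Rightarrow> 's set) \<Rightarrow> 's \<Rightarrow> bool"
  and next_wins :: "('s \<Rightarrow> 'd set) \<Rightarrow> ('s \<Rightarrow> 'd \<Rightarrow> 's set) \<Rightarrow> 's \<Rightarrow> bool"
  for decl :: "'s \<Rightarrow> 'd set" and moves :: "'s \<Rightarrow> 'd \<Rightarrow> 's set"
where
  prev_winsI: "\<lbrakk>d \<in> decl s; \<forall>t\<in>moves s d. next_wins decl moves t\<rbrakk> \<Longrightarrow> prev_wins decl moves s"
| next_winsI: "\<forall>d\<in>decl s. \<exists>t\<in>moves s d. prev_wins decl moves t \<Longrightarrow> next_wins decl moves s"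

definition P_positions :: "'s set \<Rightarrow> ('s \<Rightarrow> 's set) \<Rightarrow> 's set" where
  "P_positions board opts = {s \<in> board. prev_wins (\<lambda>_. {()}) (\<lambda>s _. opts s) s}"

fun rook_move :: "pos \<Rightarrow> pos \<Rightarrow> bool" where
  "rook_move (x, y) (x', y') \<longleftrightarrow> (x' < x \<and> y' = y) \<or> (x' = x \<and> y' < y)"

definition lq_length :: "nat \<Rightarrow> nat \<Rightarrow> nat \<Rightarrow> bool" where
  "lq_length l q d \<longleftrightarrow> d > 0 \<and> (if l = 0 then q dvd d else \<exists>i j. j < l \<and> d = i * q + j)"

text \<open>One of the two differences is zero for a rook move, so their sum is the length.\<close>

fun lq_rook_move :: "nat \<Rightarrow> nat \<Rightarrow> pos \<Rightarrow> pos \<Rightarrow> bool" where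
  "lq_rook_move l q (x, y) (x', y') \<longleftrightarrow>
     rook_move (x, y) (x', y') \<and> lq_length l q ((x - x') + (y - y'))"

fun bishop_move :: "nat \<Rightarrow> pos \<Rightarrow> pos \<Rightarrow> bool" where
  "bishop_move k (x, y) (x', y') \<longleftrightarrow>
     x' \<le> x \<and> y' \<le> y \<and> (x', y') \<noteq> (x, y) \<and>
     \<bar>(int x - int x') - (int y - int y')\<bar> < int k"

definition wythoff_opts :: "nat \<Rightarrow> pos \<Rightarrow> pos set" where
  "wythoff_opts k z = {z'. bishop_move k z z' \<or> rook_move z z'}"

definition roob_opts :: "nat \<Rightarrow> pos \<Rightarrow> pos set" where
  "roob_opts m z = {z'. rook_move z z' \<and> \<not> bishop_move m z z'}"

definition blocking_P :: "nat \<Rightarrow> nat \<Rightarrow> pos set" where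
  "blocking_P m p =
     {z. prev_wins (\<lambda>z. {B. B \<subseteq> roob_opts m z \<and> card B \<le> p - 1})
           (\<lambda>z B. wythoff_opts m z - B) z}"

definition lq_wythoff_P :: "nat \<Rightarrow> nat \<Rightarrow> nat \<Rightarrow> pos set" where
  "lq_wythoff_P m l q =
     P_positions UNIV (\<lambda>z. {z'. bishop_move m z z' \<or> lq_rook_move l q z z'})"

definition modulo_P :: "nat \<Rightarrow> nat \<Rightarrow> pos set" where
  "modulo_P m p = lq_wythoff_P m 0 p"

text \<open>
  Nothing is removed from the board when \<open>l = 0\<close>. For \<open>l > 0\<close> the terminal positions are
  \<open>(m * l, 0)\<close> and \<open>(0, m * (p - l))\<close>.
\<close>

definition shifted_board :: "nat \<Rightarrow> nat \<Rightarrow> nat \<Rightarrow> pos set" where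
  "shifted_board m p l = {(i, j). \<not> (i < m * l \<and> j < m * (p - l))}"

definition shifted_opts :: "nat \<Rightarrow> nat \<Rightarrow> nat \<Rightarrow> pos \<Rightarrow> pos set" where
  "shifted_opts m p l z = wythoff_opts (m * p) z \<inter> shifted_board m p l"

definition shifted_P :: "nat \<Rightarrow> nat \<Rightarrow> nat \<Rightarrow> pos set" where
  "shifted_P m p l = P_positions (shifted_board m p l) (shifted_opts m p l)"

text \<open>
  A state of \<open>m \<times> p\<close>-Wythoff Nim is \<open>(None, z)\<close> before the second player has chosen a shift, and
  \<open>(Some l, z)\<close> once the shift \<open>l\<close> is fixed. The chosen board has to contain the starting position,
  which is always possible with \<open>l = 0\<close>.
\<close>

fun mxp_decl :: "nat \<Rightarrow> nat \<Rightarrow> nat option \<times> pos \<Rightarrow> nat set" where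
  "mxp_decl m p (None, z) = {l. l < p \<and> z \<in> shifted_board m p l}"
| "mxp_decl m p (Some l, z) = {l}"

fun mxp_moves :: "nat \<Rightarrow> nat \<Rightarrow> nat option \<times> pos \<Rightarrow> nat \<Rightarrow> (nat option \<times> pos) set" where
  "mxp_moves m p (_, z) l = Pair (Some l) ` shifted_opts m p l z"

definition mxp_P :: "nat \<Rightarrow> nat \<Rightarrow> pos set" where
  "mxp_P m p = {z. prev_wins (mxp_decl m p) (mxp_moves m p) (None, z)}"

definition phi :: "nat \<Rightarrow> real" where
  "phi k = (2 - real k + sqrt ((real k)\<^sup>2 + 4)) / 2"

text \<open>Since \<open>phi k > 0\<close>, the conversion to \<open>nat\<close> below truncates nothing.\<close>

definition seq_a :: "nat \<Rightarrow> nat \<Rightarrow> nat \<Rightarrow> nat" where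
  "seq_a m p n = nat \<lfloor>real n * phi (m * p) / real p\<rfloor>"

definition seq_b :: "nat \<Rightarrow> nat \<Rightarrow> nat \<Rightarrow> nat" where
  "seq_b m p n = nat \<lfloor>real n * (phi (m * p) + real (m * p)) / real p\<rfloor>"

definition beatty_pairs :: "nat \<Rightarrow> nat \<Rightarrow> pos set" where
  "beatty_pairs m p = (\<Union>i. {(seq_a m p i, seq_b m p i), (seq_b m p i, seq_a m p i)})"

text \<open>
  For \<open>0 < l < p\<close> the terminal position \<open>(m * l, 0)\<close> is \<open>(seq_b m p l, seq_a m p l)\<close>, larger
  coordinate first. The \<open>P\<close>-positions of the \<open>l\<close>-shifted game are therefore the pairs
  \<open>(b\<^sub>i, a\<^sub>i)\<close> with \<open>i\<close> congruent to \<open>l\<close> modulo \<open>p\<close> and the pairs \<open>(a\<^sub>i, b\<^sub>i)\<close> with \<open>i\<close>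
  congruent to \<open>-l\<close>; exchanging the two coordinates gives a false statement, as the pair
  \<open>(a\<^sub>1, b\<^sub>1) = (0, 1)\<close> shows for \<open>m = 1\<close>, \<open>p = 3\<close>, \<open>l = 1\<close>.
\<close>

lemma shifted_orientation: "(seq_a 1 3 1, seq_b 1 3 1) \<notin> shifted_P 1 3 1"
proof -
  have "sqrt 13 > 3" "sqrt 13 < 4"
    by (auto intro: real_less_rsqrt real_less_lsqrt)
  then have "\<lfloor>phi 3 / 3\<rfloor> = 0" "\<lfloor>(phi 3 + 3) / 3\<rfloor> = 1"
    by (auto simp: phi_def floor_eq_iff)
  then have "seq_a 1 3 1 = 0" "seq_b 1 3 1 = 1"
    by (simp_all add: seq_a_def seq_b_def)
  then show ?thesis
    by (simp add: shifted_P_def P_positions_def shifted_board_def)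
qed

end

theory Submission
  imports Defs
begin

text \<open>
  List the pairs along all diagonals: for an integer \<open>n\<close> let \<open>E n\<close> be \<open>(b\<^sub>n, a\<^sub>n)\<close> if
  \<open>n \<ge> 0\<close> and \<open>(a\<^sub>-\<^sub>n, b\<^sub>-\<^sub>n)\<close> otherwise, so that the coordinates of \<open>E n\<close>
  differ by \<open>m * n\<close>. By an inhomogeneous version of Beatty's theorem, every row contains exactly one
  \<open>E n\<close> for each residue class of \<open>n\<close> modulo \<open>p\<close>. In each of the games, a rook-type move between two
  of the positions would stay in one residue class (or can be blocked, as there are at most
  \<open>p - 1\<close> of them). From another position \<open>(x, y)\<close> with \<open>x \<ge> y\<close>, say, one finds the right \<open>E n\<close> in the
  row of \<open>(x, y)\<close>; if it lies too far to the right, monotonicity of \<open>a\<close> puts the closest \<open>E n\<^sub>0\<close>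
  with \<open>m * n\<^sub>0 \<le> x - y\<close> within reach of a bishop.
\<close>

section \<open>Recognising the previous player's wins\<close>

text \<open>Once the verdict is known for every state reachable in one move, unfolding each
  predicate a single time leaves exactly \<open>stable\<close> and \<open>absorbing\<close>; the
  measure \<open>\<mu>\<close> supplies the induction. The set \<open>B\<close> restricts attention
  to legal states, which the games on a truncated board require.\<close>

lemma wins_iff:
  fixes \<mu> :: "'s \<Rightarrow> nat"
  assumes closed: "\<And>s d t. s \<in> B \<Longrightarrow> d \<in> decl s \<Longrightarrow> t \<in> moves s d \<Longrightarrow> t \<in> B \<and> \<mu> t < \<mu> s"
    and stable: "\<And>s. s \<in> B \<Longrightarrow> s \<in> S \<Longrightarrow> \<exists>d\<in>decl s. moves s d \<inter> S = {}"
    and absorbing: "\<And>s d. s \<in> B \<Longrightarrow> s \<notin> S \<Longrightarrow> d \<in> decl s \<Longrightarrow> moves s d \<inter> S \<noteq> {}"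
    and "s \<in> B"
  shows "(prev_wins decl moves s \<longleftrightarrow> s \<in> S) \<and> (next_wins decl moves s \<longleftrightarrow> s \<notin> S)"
  using \<open>s \<in> B\<close>
proof (induction "\<mu> s" arbitrary: s rule: less_induct)
  case less
  have IH: "(prev_wins decl moves t \<longleftrightarrow> t \<in> S) \<and> (next_wins decl moves t \<longleftrightarrow> t \<notin> S)"
    if "d \<in> decl s" "t \<in> moves s d" for d t
    using less closed that by blast
  have prev: "prev_wins decl moves s \<longleftrightarrow> (\<exists>d\<in>decl s. \<forall>t\<in>moves s d. t \<notin> S)"
    using IH by (subst prev_wins.simps) blast
  have "next": "next_wins decl moves s \<longleftrightarrow> (\<forall>d\<in>decl s. \<exists>t\<in>moves s d. t \<in> S)"
    using IH by (subst next_wins.simps) blast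
  show ?case
    unfolding prev "next" using stable[of s] absorbing[of s] less.prems by blast
qed

lemma P_positions_eq:
  fixes \<mu> :: "'s \<Rightarrow> nat"
  assumes "\<And>s t. s \<in> B \<Longrightarrow> t \<in> opts s \<Longrightarrow> t \<in> B \<and> \<mu> t < \<mu> s"
    and "\<And>s. s \<in> S \<Longrightarrow> opts s \<inter> S = {}"
    and "\<And>s. s \<in> B \<Longrightarrow> s \<notin> S \<Longrightarrow> opts s \<inter> S \<noteq> {}"
    and "S \<subseteq> B"
  shows "P_positions B opts = S"
proof -
  have "prev_wins (\<lambda>_. {()}) (\<lambda>s _. opts s) s \<longleftrightarrow> s \<in> S" if "s \<in> B" for s
    using wins_iff[of B "\<lambda>_. {()}" "\<lambda>s _. opts s" \<mu> S s] assms that by blast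
  then show ?thesis
    using \<open>S \<subseteq> B\<close> unfolding P_positions_def by blast
qed

text \<open>Simultaneous induction on the two derivations, with no termination measure, so it
  applies to any game. It provides the converse direction: what follows if a given set is known to
  be the set of P-positions.\<close>

lemma not_next_wins_if_prev_wins:
  shows "prev_wins decl moves s \<Longrightarrow> \<not> next_wins decl moves s"
    and "next_wins decl moves s \<Longrightarrow> \<not> prev_wins decl moves s"
proof (induction s and s rule: prev_wins_next_wins.inducts)
  case (prev_winsI d s)
  then show ?case by (subst next_wins.simps) blast
next
  case (next_winsI s)
  then show ?case by (subst prev_wins.simps) blast
qed

lemma P_positions_no_move:
  assumes "s \<in> P_positions B opts" "t \<in> P_positions B opts"
  shows "t \<notin> opts s"
proof
  assume "t \<in> opts s"
  have wins: "prev_wins (\<lambda>_. {()}) (\<lambda>s _. opts s) s" "prev_wins (\<lambda>_. {()}) (\<lambda>s _. opts s) t"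
    using assms by (auto simp: P_positions_def)
  from wins(1) have "next_wins (\<lambda>_. {()}) (\<lambda>s _. opts s) t"
    by cases (use \<open>t \<in> opts s\<close> in blast)
  then show False using not_next_wins_if_prev_wins(1)[OF wins(2)] by contradiction
qed

section \<open>Moves\<close>

lemma bishop_move_swap: "bishop_move k (prod.swap z) (prod.swap z') = bishop_move k z z'"
  by (cases z; cases z') auto

lemma rook_move_swap: "rook_move (prod.swap z) (prod.swap z') = rook_move z z'"
  by (cases z; cases z') auto

lemma lq_rook_move_swap: "lq_rook_move l q (prod.swap z) (prod.swap z') = lq_rook_move l q z z'"
  by (cases z; cases z') (auto simp: add.commute)

lemma rook_move_decreases: "rook_move z z' \<Longrightarrow> fst z' + snd z' < fst z + snd z"
  by (cases z; cases z') auto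

lemma lq_rook_move_imp_rook_move: "lq_rook_move l q z z' \<Longrightarrow> rook_move z z'"
  by (cases z; cases z') auto

lemma bishop_move_decreases: "bishop_move k z z' \<Longrightarrow> fst z' + snd z' < fst z + snd z"
  by (cases z; cases z') auto

lemma wythoff_opts_decreases: "z' \<in> wythoff_opts k z \<Longrightarrow> fst z' + snd z' < fst z + snd z"
  unfolding wythoff_opts_def using rook_move_decreases bishop_move_decreases by blast

section \<open>The pairs along the diagonals\<close>

text \<open>A rational root in lowest terms has denominator 1. But \<open>k^2 + 4\<close> lies
  strictly between \<open>k^2\<close> and \<open>(k + 2)^2\<close>, so an integer root would be
  \<open>k + 1\<close>, which forces \<open>2 * k + 1 = 4\<close> and fails by parity.\<close>

lemma sqrt_square_plus_4_irrational:
  assumes "k \<ge> (1::nat)"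
  shows "sqrt ((real k)\<^sup>2 + 4) \<notin> \<rat>"
proof
  assume "sqrt ((real k)\<^sup>2 + 4) \<in> \<rat>"
  then obtain a b :: nat
    where b: "b \<noteq> 0" and ab: "\<bar>sqrt ((real k)\<^sup>2 + 4)\<bar> = real a / real b" and cop: "coprime a b"
    by (rule Rats_abs_nat_div_natE)
  have "(real a / real b)\<^sup>2 = (real k)\<^sup>2 + 4"
    unfolding ab[symmetric] by simp
  then have "(real a)\<^sup>2 = ((real k)\<^sup>2 + 4) * (real b)\<^sup>2"
    using b by (simp add: power_divide divide_eq_eq)
  then have "real (a\<^sup>2) = real ((k\<^sup>2 + 4) * b\<^sup>2)" by simp
  then have eq: "a\<^sup>2 = (k\<^sup>2 + 4) * b\<^sup>2" by (rule of_nat_eq_iff[THEN iffD1])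
  then have "b\<^sup>2 dvd a\<^sup>2" by (rule dvdI[OF trans[OF _ mult.commute]])
  then have "b dvd a" by simp
  then have "b = 1" using cop by (simp add: coprime_absorb_right)
  then have sq: "a\<^sup>2 = k\<^sup>2 + 4" using eq by simp
  have "k < a" by (rule power_less_imp_less_base[of k 2 a]) (simp_all add: sq)
  moreover have "a < k + 2"
  proof (rule ccontr)
    assume "\<not> a < k + 2"
    then have "(k + 2)\<^sup>2 \<le> a\<^sup>2" by (intro power_mono) auto
    then show False using sq assms by (simp add: power2_eq_square algebra_simps)
  qed
  ultimately have "a = k + 1" by simp
  then have "2 * k + 1 = 4" using sq by (simp add: power2_eq_square algebra_simps)
  then show False by presburger
qed

section \<open>The slopes of the two sequences and the pairs indexed by the integers\<close>

locale wythoff_pairs =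
  fixes m p :: nat
  assumes m: "m \<ge> 1" and p: "p \<ge> 1"
begin

definition \<alpha> :: real where "\<alpha> = phi (m * p) / p"

definition \<beta> :: real where "\<beta> = \<alpha> + m"

definition E :: "int \<Rightarrow> pos" where
  "E n = (if 0 \<le> n then (seq_b m p (nat n), seq_a m p (nat n))
          else (seq_a m p (nat (- n)), seq_b m p (nat (- n))))"

lemma mp_pos: "m * p \<ge> 1"
  using m p by simp

lemma phi_pos: "phi (m * p) > 0"
proof -
  have "real (m * p) < sqrt ((real (m * p))\<^sup>2 + 4)"
    by (intro real_less_rsqrt) simp
  then show ?thesis by (simp add: phi_def)
qed

lemma alpha_pos: "\<alpha> > 0"
  using phi_pos p by (simp add: \<alpha>_def)

lemma beta_gt_1: "\<beta> > 1"
  using alpha_pos m by (simp add: \<beta>_def)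

text \<open>\<open>phi k\<close> is the positive root of \<open>t * (t + k) = 2 * t + k\<close>;
  dividing by the left side with \<open>k = m * p\<close> gives the identity. For
  \<open>p = 1\<close> it is the condition of Beatty's theorem; in general it says that a row holds
  \<open>p\<close> pairs on average.\<close>

lemma inverse_alpha_plus_inverse_beta: "1 / \<alpha> + 1 / \<beta> = p"
proof -
  define k \<phi> where "k = real (m * p)" and "\<phi> = phi (m * p)"
  have k: "k = real m * real p" by (simp add: k_def)
  have "2 * \<phi> - (2 - k) = sqrt (k\<^sup>2 + 4)"
    by (simp add: \<phi>_def k_def phi_def field_simps)
  then have "(2 * \<phi> - (2 - k))\<^sup>2 = k\<^sup>2 + 4" by simp
  then have quad: "\<phi> * (\<phi> + k) = 2 * \<phi> + k"
    by (simp add: power2_eq_square algebra_simps)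
  have pos: "\<phi> > 0" "k > 0" "real p > 0"
    using phi_pos mp_pos p by (auto simp: \<phi>_def k_def)
  have "1 / \<alpha> + 1 / \<beta> = p / \<phi> + p / (\<phi> + k)"
    using pos by (simp add: \<beta>_def \<alpha>_def \<phi>_def[symmetric] k field_simps)
  also have "\<dots> = p * (2 * \<phi> + k) / (\<phi> * (\<phi> + k))"
    using pos by (simp add: field_simps)
  also have "\<dots> = p" using pos by (simp add: quad)
  finally show ?thesis .
qed

lemma alpha_irrational: "\<alpha> \<notin> \<rat>"
proof
  assume "\<alpha> \<in> \<rat>"
  then have "2 * (\<alpha> * p) - 2 + real (m * p) \<in> \<rat>"
    by (intro Rats_add Rats_diff Rats_mult) auto
  moreover have "2 * (\<alpha> * p) - 2 + real (m * p) = sqrt ((real (m * p))\<^sup>2 + 4)"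
    using p by (simp add: \<alpha>_def phi_def field_simps)
  ultimately show False
    using sqrt_square_plus_4_irrational[OF mp_pos] by simp
qed

lemma divide_alpha_not_int:
  fixes z :: int and k :: nat
  assumes "k \<noteq> 0"
  shows "k / \<alpha> \<noteq> z"
proof
  assume "k / \<alpha> = z"
  then have "\<alpha> = k / z" using alpha_pos assms by (auto simp: field_simps)
  then show False using alpha_irrational by (metis Rats_divide Rats_of_int Rats_of_nat)
qed

lemma seq_a_eq: "seq_a m p n = nat \<lfloor>n * \<alpha>\<rfloor>"
  by (simp add: seq_a_def \<alpha>_def)

lemma seq_b_eq: "seq_b m p n = nat \<lfloor>n * \<beta>\<rfloor>"
proof -
  have "real n * (phi (m * p) + real (m * p)) / real p = n * \<beta>"
    using p by (simp add: \<beta>_def \<alpha>_def field_simps)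
  then show ?thesis by (simp add: seq_b_def)
qed

lemma seq_b_eq_seq_a: "seq_b m p n = seq_a m p n + m * n"
proof -
  have "real n * \<beta> = n * \<alpha> + int (m * n)"
    by (simp add: \<beta>_def algebra_simps)
  then have "\<lfloor>n * \<beta>\<rfloor> = \<lfloor>n * \<alpha>\<rfloor> + int (m * n)"
    by (metis floor_add_int)
  moreover have "\<lfloor>n * \<alpha>\<rfloor> \<ge> 0" using alpha_pos by simp
  ultimately show ?thesis
    by (simp add: seq_a_eq seq_b_eq nat_add_distrib nat_mult_distrib)
qed

lemma seq_a_mono: "i \<le> j \<Longrightarrow> seq_a m p i \<le> seq_a m p j"
  unfolding seq_a_eq using alpha_pos by (intro nat_mono floor_mono mult_right_mono) auto

text \<open>As \<open>1 / \<beta> < 1\<close>, the sum of reciprocals gives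
  \<open>1 / \<alpha> > p - 1\<close>. Hence \<open>E j = (m * j, 0)\<close> for
  \<open>j < p\<close>, which identifies the terminal positions of the shifted games.\<close>

lemma seq_a_eq_0:
  assumes "n < p"
  shows "seq_a m p n = 0"
proof -
  have "1 / \<beta> < 1" using beta_gt_1 by simp
  then have "real p - 1 < 1 / \<alpha>" using inverse_alpha_plus_inverse_beta by linarith
  moreover have "real n \<le> real p - 1" using assms by linarith
  ultimately have "real n < 1 / \<alpha>" by linarith
  then have "n * \<alpha> < 1" using alpha_pos by (simp add: field_simps)
  then show ?thesis using alpha_pos by (simp add: seq_a_eq floor_le_iff)
qed

lemma E_minus: "E (- n) = prod.swap (E n)"
  by (cases "n = 0") (auto simp: E_def seq_b_eq_seq_a)

lemma E_diff: "int (fst (E n)) - int (snd (E n)) = int m * n"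
  by (auto simp: E_def seq_b_eq_seq_a)

lemma E_inj: "E i = E j \<longleftrightarrow> i = j"
proof
  assume "E i = E j"
  then have "int m * i = int m * j" by (simp flip: E_diff)
  then show "i = j" using m by simp
qed simp

lemma range_E: "range E = beatty_pairs m p"
proof
  show "range E \<subseteq> beatty_pairs m p"
    by (auto simp: E_def beatty_pairs_def)
  have "(seq_b m p i, seq_a m p i) = E (int i)" for i by (simp add: E_def)
  moreover have "(seq_a m p i, seq_b m p i) = E (- int i)" for i
    unfolding E_minus by (simp add: E_def)
  ultimately show "beatty_pairs m p \<subseteq> range E"
    unfolding beatty_pairs_def by blast
qed

lemma swap_in_range_E: "prod.swap z \<in> range E \<longleftrightarrow> z \<in> range E"
proof -
  have "prod.swap z \<in> range E" if "z \<in> range E" for z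
  proof -
    obtain n where "z = E n" using \<open>z \<in> range E\<close> by blast
    then have "prod.swap z = E (- n)" by (simp add: E_minus)
    then show ?thesis by simp
  qed
  from this[of z] this[of "prod.swap z"] show ?thesis by auto
qed

lemma snd_E_mono:
  assumes "0 \<le> i" "i \<le> j"
  shows "snd (E i) \<le> snd (E j)"
  using assms seq_a_mono[of "nat i" "nat j"] by (simp add: E_def)

section \<open>Inhomogeneous Beatty theorem: one pair for each row and residue class\<close>

lemma floor_mult_eq_iff:
  fixes x :: real
  assumes "x > 0"
  shows "nat \<lfloor>n * x\<rfloor> = y \<longleftrightarrow> y / x \<le> real n \<and> real n < (real y + 1) / x"
proof -
  have "nat \<lfloor>n * x\<rfloor> = y \<longleftrightarrow> \<lfloor>n * x\<rfloor> = int y"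
    using assms by (simp add: nat_eq_iff)
  then show ?thesis
    using assms by (simp add: floor_eq_iff field_simps)
qed

text \<open>
  For negative \<open>n\<close>, shifting by a multiple of \<open>p\<close> fills the remainder of an interval of length \<open>p\<close>,
  because \<open>1 / \<beta> = p - 1 / \<alpha>\<close>.
\<close>

lemma snd_E_eq_iff:
  fixes n :: int
  shows "snd (E n) = y \<longleftrightarrow>
     (if 0 \<le> n then y / \<alpha> \<le> n \<and> n < (real y + 1) / \<alpha>
      else (real y + 1) / \<alpha> < n + p * (y + 1) \<and> n + p * (y + 1) \<le> y / \<alpha> + p)"
proof (cases "0 \<le> n")
  case True
  then show ?thesis
    using floor_mult_eq_iff[OF alpha_pos, of "nat n" y] by (simp add: E_def seq_a_eq)
next
  case False
  have 1: "1 / \<beta> = p - 1 / \<alpha>" using inverse_alpha_plus_inverse_beta by linarith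
  have "t / \<beta> = t * p - t / \<alpha>" for t :: real
    using arg_cong[OF 1, of "\<lambda>s. t * s"] by (simp add: right_diff_distrib)
  moreover have "\<beta> > 0" using beta_gt_1 by simp
  moreover have "snd (E n) = y \<longleftrightarrow> y / \<beta> \<le> - real_of_int n \<and> - real_of_int n < (real y + 1) / \<beta>"
    using floor_mult_eq_iff[of \<beta> "nat (- n)" y] False \<open>\<beta> > 0\<close>
    by (simp add: E_def seq_b_eq)
  ultimately have "snd (E n) = y \<longleftrightarrow> real y * real p - y / \<alpha> \<le> - real_of_int n
      \<and> - real_of_int n < (real y + 1) * p - (real y + 1) / \<alpha>"
    by simp
  moreover have "(real y + 1) * p = p * (real y + 1)" "real y * real p = real p * real y"
    by (simp_all add: algebra_simps)
  ultimately show ?thesis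
    using False by (auto simp: distrib_left)
qed

lemma ex_snd_E: "\<exists>n. n mod int p = c mod int p \<and> snd (E n) = y"
proof -
  define v where "v = \<lceil>y / \<alpha>\<rceil>"
  \<comment> \<open>\<open>N\<close> represents the class of \<open>c\<close> among the
    \<open>p\<close> consecutive integers starting at \<open>v\<close>, all of which lie between
    \<open>y / \<alpha>\<close> and \<open>y / \<alpha> + p\<close>. The point
    \<open>(real y + 1) / \<alpha>\<close> decides whether \<open>N\<close> comes from a nonnegative
    index or from a shifted negative one.\<close>
  define N where "N = v + (c - v) mod int p"
  have modN: "N mod int p = c mod int p"
    by (simp add: N_def mod_add_right_eq)
  have "(c - v) mod int p \<ge> 0" "(c - v) mod int p \<le> int p - 1"
    using p pos_mod_bound[of "int p" "c - v"] by auto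
  then have N: "v \<le> N" "N \<le> v + int p - 1" by (auto simp: N_def)
  have v: "y / \<alpha> \<le> v" "v < y / \<alpha> + 1" unfolding v_def by linarith+
  have lo: "y / \<alpha> \<le> N" using N v by linarith
  have hi: "N \<le> y / \<alpha> + p" using N v by linarith
  have nonneg: "y / \<alpha> \<ge> 0" using alpha_pos by simp
  show ?thesis
  proof (cases "N < (real y + 1) / \<alpha>")
    case True
    have "0 \<le> N" using lo nonneg by linarith
    then show ?thesis using True lo modN by (auto simp: snd_E_eq_iff intro!: exI[of _ N])
  next
    case False
    \<comment> \<open>The negative case of \<open>snd_E_eq_iff\<close> demands a strict inequality;
      irrationality excludes equality.\<close>
    have N_gt: "(real y + 1) / \<alpha> < N"
      using False divide_alpha_not_int[of "y + 1" N] by (simp add: add.commute)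
    define n where "n = N - int p * (int y + 1)"
    have "y / \<beta> = y * p - y / \<alpha>"
      using arg_cong[OF inverse_alpha_plus_inverse_beta, of "\<lambda>s. y * s"]
      by (simp add: distrib_left)
    moreover have "y / \<beta> \<ge> 0" using beta_gt_1 by simp
    moreover have "N < y / \<alpha> + p" using N v by linarith
    ultimately have "real_of_int n < 0" by (simp add: n_def algebra_simps)
    then have "n < 0" by linarith
    moreover have "N mod int p = n mod int p"
      unfolding n_def mod_eq_dvd_iff by simp
    ultimately show ?thesis
      using N_gt hi modN by (intro exI[of _ n]) (simp add: snd_E_eq_iff n_def distrib_left)
  qed
qed

lemma snd_E_inj_on_class:
  assumes mod: "i mod int p = j mod int p" and snd: "snd (E i) = snd (E j)"
  shows "i = j"
proof -
  define y where "y = snd (E i)"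
  have y: "snd (E i) = y" "snd (E j) = y" using snd by (auto simp: y_def)
  \<comment> \<open>\<open>N\<close> undoes the shift of negative indices, so all indices of row
    \<open>y\<close> land between \<open>v\<close> and \<open>v + p\<close> without changing their
    residue. Two of them in one class therefore differ by 0 or by \<open>p\<close> in absolute
    value.\<close>
  define N where "N n = (if 0 \<le> n then n else n + int p * (int y + 1))" for n :: int
  define v w where "v = y / \<alpha>" and "w = (real y + 1) / \<alpha>"
  have "\<alpha> * p > 1"
  proof -
    have "1 / \<beta> > 0" using beta_gt_1 by simp
    then have "1 / \<alpha> < p" using inverse_alpha_plus_inverse_beta by linarith
    then show ?thesis using alpha_pos by (simp add: field_simps)
  qed
  then have vw: "v < w" "w < v + p"
    using alpha_pos by (auto simp: v_def w_def field_simps)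
  have bounds: "if 0 \<le> n then v \<le> N n \<and> N n < w else w < N n \<and> N n \<le> v + p"
    if "snd (E n) = y" for n
    using that[unfolded snd_E_eq_iff] by (auto simp: N_def v_def w_def distrib_left)
  have le: "\<bar>N i - N j\<bar> \<le> int p"
    using bounds[OF y(1)] bounds[OF y(2)] vw by (auto split: if_splits)
  have N_mod: "N n mod int p = n mod int p" for n by (simp add: N_def)
  have "int p dvd N i - N j"
    using mod N_mod by (metis mod_eq_dvd_iff)
  then obtain k where k: "N i - N j = int p * k" by blast
  have "\<bar>k\<bar> \<le> 1"
    using le p by (simp add: k abs_mult)
  then have "k = 0 \<or> k = 1 \<or> k = -1" by arith
  then consider "N i = N j" | "N i = N j + int p" | "N j = N i + int p"
    using k by fastforce
  \<comment> \<open>A difference of \<open>p\<close> uses both ends of the interval, so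
    \<open>v\<close> is an integer, which irrationality allows only for \<open>y = 0\<close>. Then
    \<open>N a = p\<close> must come from a negative \<open>a\<close> with \<open>a + p = p\<close>,
    which is absurd.\<close>
  moreover have False if ab: "N a = N b + int p" and a: "snd (E a) = y" and b: "snd (E b) = y" for a b
  proof -
    have "v \<le> N b" "N b + p \<le> v + p"
      using bounds[OF a] bounds[OF b] ab vw by (auto split: if_splits)
    then have "v = N b" by simp
    then have "y = 0" using divide_alpha_not_int[of y "N b"] by (auto simp: v_def)
    then have "v = 0" by (simp add: v_def)
    then have Na: "N a = int p" using \<open>v = N b\<close> ab by simp
    then have "a < 0" using bounds[OF a] vw \<open>v = 0\<close> by (auto split: if_splits)
    then show False using Na \<open>y = 0\<close> by (simp add: N_def)
  qed
  ultimately show ?thesis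
  proof cases
    case 1
    then show ?thesis
      using bounds[OF y(1)] bounds[OF y(2)] by (auto simp: N_def split: if_splits)
  qed (use y in blast)+
qed

lemma fst_E: "fst (E n) = snd (E (- n))"
  by (simp add: E_minus)

section \<open>Moves between the pairs\<close>

text \<open>The quantity bounded by \<open>k\<close> in a bishop move is here
  \<open>m * (i - j)\<close>, a nonzero multiple of \<open>k\<close>. The cases of interest are
  \<open>k = m\<close> with arbitrary indices and \<open>k = m * p\<close> with indices congruent
  modulo \<open>p\<close>.\<close>

lemma no_bishop_move_E:
  assumes "int k dvd int m * (i - j)"
  shows "\<not> bishop_move k (E i) (E j)"
proof
  assume bishop: "bishop_move k (E i) (E j)"
  obtain x y x' y' where E: "E i = (x, y)" "E j = (x', y')" by fastforce
  have "E i \<noteq> E j" using bishop unfolding E bishop_move.simps by auto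
  then have "i \<noteq> j" by auto
  have "int m * (i - j) = (int x - int x') - (int y - int y')"
    using E_diff[of i] E_diff[of j] by (simp add: E algebra_simps)
  then have "\<bar>int m * (i - j)\<bar> < int k" using bishop unfolding E bishop_move.simps by simp
  moreover have "int m * (i - j) \<noteq> 0" using m \<open>i \<noteq> j\<close> by simp
  ultimately show False using dvd_imp_le_int[OF _ assms] by simp
qed

lemma no_m_bishop_move_E: "\<not> bishop_move m (E i) (E j)"
  by (intro no_bishop_move_E) simp

lemma no_mp_bishop_move_E:
  assumes "i mod int p = j mod int p"
  shows "\<not> bishop_move (m * p) (E i) (E j)"
  using assms by (intro no_bishop_move_E) (simp add: mod_eq_dvd_iff mult_dvd_mono)

text \<open>Moves along a row contradict uniqueness within the class; moves along a column reduce to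
  rows by negating the indices, which also preserves congruence.\<close>

lemma no_rook_move_E:
  assumes "i mod int p = j mod int p"
  shows "\<not> rook_move (E i) (E j)"
proof
  assume rook: "rook_move (E i) (E j)"
  have "(- i) mod int p = (- j) mod int p" using assms by (rule mod_minus_cong)
  moreover have "fst (E i) = fst (E j) \<or> snd (E i) = snd (E j)"
    using rook by (cases "E i"; cases "E j") auto
  ultimately have "i = j"
    using assms snd_E_inj_on_class[of i j] snd_E_inj_on_class[of "- i" "- j"] by (auto simp: fst_E)
  then show False using rook rook_move_decreases by blast
qed

lemma lq_rook_move_E_length:
  assumes "lq_rook_move l q (E i) (E j)"
  shows "lq_length l q (m * nat \<bar>i - j\<bar>)"
proof -
  obtain x y x' y' where E: "E i = (x, y)" "E j = (x', y')" by fastforce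
  have rook: "x' < x \<and> y' = y \<or> x' = x \<and> y' < y" and
    len: "lq_length l q ((x - x') + (y - y'))"
    using assms by (simp_all add: E)
  have diff: "int m * (i - j) = (int x - int x') - (int y - int y')"
    using E_diff[of i] E_diff[of j] by (simp add: E algebra_simps)
  have "int (m * nat \<bar>i - j\<bar>) = \<bar>int m * (i - j)\<bar>"
    by (simp add: abs_mult)
  also have "\<dots> = int ((x - x') + (y - y'))"
    using rook unfolding diff by auto
  finally show ?thesis using len by (simp only: of_nat_eq_iff)
qed

text \<open>This is the winning move common to all the games. If \<open>E n\<close> lies to the
  right of \<open>(x, y)\<close>, its diagonal exceeds that of \<open>E n0\<close>, so
  \<open>n0 < n\<close>, and monotonicity puts \<open>E n0\<close> no higher than row
  \<open>y\<close>. The bounds \<open>d\<close> then put it no further right than \<open>x\<close>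
  and within the bishop's tolerance \<open>k\<close>.\<close>

lemma rook_or_bishop_move_to_E:
  assumes row: "snd (E n) = y" and n0: "0 \<le> n0"
    and d: "int m * n0 \<le> int x - int y" "int x - int y < int m * n0 + int k"
    and ne: "(x, y) \<noteq> E n" "(x, y) \<noteq> E n0"
  shows "rook_move (x, y) (E n) \<or> bishop_move k (x, y) (E n0)"
proof -
  obtain x' where En: "E n = (x', y)" using row by (metis prod.collapse)
  obtain X Y where En0: "E n0 = (X, Y)" by fastforce
  consider "x' < x" | "x < x'" using En ne(1) by fastforce
  then show ?thesis
  proof cases
    case 1
    then show ?thesis by (simp add: En)
  next
    case 2
    have "int x' - int y = int m * n" using E_diff[of n] by (simp add: En)
    then have "int m * n0 < int m * n" using 2 d by linarith
    then have "n0 < n" using m by (simp add: mult_less_cancel_left_pos)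
    then have "Y \<le> y" using snd_E_mono[OF n0, of n] by (simp add: En En0)
    moreover have XY: "int X - int Y = int m * n0" using E_diff[of n0] by (simp add: En0)
    ultimately have "X \<le> x" using d by linarith
    then have "bishop_move k (x, y) (X, Y)"
      using d XY \<open>Y \<le> y\<close> ne(2)[unfolded En0] unfolding bishop_move.simps by auto
    then show ?thesis by (simp add: En0)
  qed
qed

lemma m_div_bounds:
  fixes x y :: nat
  assumes "y \<le> x"
  shows "int m * int ((x - y) div m) \<le> int x - int y"
    and "int x - int y < int m * int ((x - y) div m) + int m"
proof -
  have eq: "int m * int ((x - y) div m) + int ((x - y) mod m) = int x - int y"
    using assms by (simp flip: of_nat_mult of_nat_add)
  have "(x - y) mod m < m" using m by simp
  then show "int m * int ((x - y) div m) \<le> int x - int y"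
    and "int x - int y < int m * int ((x - y) div m) + int m"
    unfolding eq[symmetric] by simp_all
qed

section \<open>Games with restricted rook moves\<close>

text \<open>Rook moves between pairs have length \<open>m * \<bar>i - j\<bar>\<close>, so
  \<open>closed\<close> confines them to one residue class, where none exist. Conversely, the
  distance from \<open>(x, y)\<close> to a pair \<open>E n\<close> further left in its row is
  \<open>x - y - m * n\<close>; \<open>reach\<close> names a class in which every such distance is a
  legal length.\<close>

lemma lq_wythoff_P_eq:
  assumes closed: "\<And>t. lq_length l q (m * t) \<Longrightarrow> p dvd t"
    and reach: "\<And>d. \<exists>c. \<forall>n. n mod int p = c mod int p \<longrightarrow> int m * n < int d \<longrightarrow>
      lq_length l q (nat (int d - int m * n))"
  shows "lq_wythoff_P m l q = beatty_pairs m p"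
  unfolding lq_wythoff_P_def range_E[symmetric]
proof (rule P_positions_eq[where \<mu> = "\<lambda>z. fst z + snd z"])
  let ?opts = "\<lambda>z. {z'. bishop_move m z z' \<or> lq_rook_move l q z z'}"
  show "t \<in> UNIV \<and> fst t + snd t < fst s + snd s" if "t \<in> ?opts s" for s t :: pos
    using that lq_rook_move_imp_rook_move rook_move_decreases bishop_move_decreases by blast
  have "\<not> lq_rook_move l q (E i) (E j)" for i j
  proof
    assume lq: "lq_rook_move l q (E i) (E j)"
    then have "p dvd nat \<bar>i - j\<bar>" using lq_rook_move_E_length closed by blast
    then have "i mod int p = j mod int p" by (simp add: mod_eq_dvd_iff)
    then show False using lq lq_rook_move_imp_rook_move no_rook_move_E by blast
  qed
  then show "?opts s \<inter> range E = {}" if "s \<in> range E" for s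
    using that no_m_bishop_move_E by auto
  have main: "?opts (x, y) \<inter> range E \<noteq> {}" if xy: "(x, y) \<notin> range E" "y \<le> x" for x y
  proof -
    define n0 where "n0 = int ((x - y) div m)"
    obtain c where c: "\<And>n. n mod int p = c mod int p \<Longrightarrow> int m * n < int (x - y) \<Longrightarrow>
        lq_length l q (nat (int (x - y) - int m * n))"
      using reach[of "x - y"] by blast
    obtain n where n: "n mod int p = c mod int p" "snd (E n) = y"
      using ex_snd_E by blast
    consider "rook_move (x, y) (E n)" | "bishop_move m (x, y) (E n0)"
      using rook_or_bishop_move_to_E[OF n(2), of n0 x m] m_div_bounds[OF \<open>y \<le> x\<close>] xy(1)
      unfolding n0_def by auto
    then show ?thesis
    proof cases
      case 1
      obtain x' where En: "E n = (x', y)" using n(2) by (metis prod.collapse)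
      then have "x' < x" using 1 by simp
      have len: "int (x - y) - int m * n = int (x - x')"
        using E_diff[of n] \<open>x' < x\<close> \<open>y \<le> x\<close> by (simp add: En)
      have "0 < int (x - x')" using \<open>x' < x\<close> by simp
      then have "int m * n < int (x - y)" unfolding len[symmetric] by simp
      then have "lq_length l q (x - x')"
        using c[OF n(1)] unfolding len nat_int by blast
      then have "lq_rook_move l q (x, y) (E n)" using \<open>x' < x\<close> by (simp add: En)
      then show ?thesis by blast
    qed blast
  qed
  show "?opts s \<inter> range E \<noteq> {}" if s: "s \<notin> range E" for s
  proof (cases "snd s \<le> fst s")
    case True
    then show ?thesis using main[of "fst s" "snd s"] s by simp
  next
    case False
    then have "?opts (prod.swap s) \<inter> range E \<noteq> {}"
      using main[of "snd s" "fst s"] s swap_in_range_E[of s] by (simp add: prod.swap_def)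
    then obtain t where "t \<in> ?opts (prod.swap s)" "t \<in> range E" by blast
    then have "prod.swap t \<in> ?opts s" "prod.swap t \<in> range E"
      using bishop_move_swap[of m s "prod.swap t"] lq_rook_move_swap[of l q s "prod.swap t"]
      by (auto simp: swap_in_range_E)
    then show ?thesis by blast
  qed
qed simp

lemma lq_wythoff_P_m_mp: "lq_wythoff_P m m (m * p) = beatty_pairs m p"
proof (rule lq_wythoff_P_eq)
  fix t
  assume "lq_length m (m * p) (m * t)"
  then obtain i j where ij: "j < m" "m * t = i * (m * p) + j"
    using m unfolding lq_length_def by auto
  have "m dvd i * (m * p) + j" unfolding ij(2)[symmetric] by simp
  then have "m dvd j" by (simp add: dvd_add_right_iff)
  then have "j = 0" using ij(1) by (auto dest: dvd_imp_le)
  then have "m * t = m * (i * p)" using ij(2) by (simp only: mult.left_commute add_0_right)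
  then have "t = i * p" using m by (simp only: mult_cancel1) simp
  then show "p dvd t" by simp
next
  fix d :: nat
  \<comment> \<open>A pair to the left with \<open>n\<close> congruent to \<open>c\<close> has
    \<open>n \<le> c\<close>, so its distance \<open>m * (c - n) + r\<close> is a multiple of
    \<open>m * p\<close> plus a remainder \<open>r < m\<close>, as the rook requires.\<close>
  define c r where "c = int (d div m)" and "r = d mod m"
  have d: "int d = int m * c + int r"
    by (simp add: c_def r_def flip: of_nat_mult of_nat_add)
  have "r < m" using m by (simp add: r_def)
  have "lq_length m (m * p) (nat (int d - int m * n))"
    if n: "n mod int p = c mod int p" "int m * n < int d" for n
  proof -
    have "int p dvd c - n" using n(1) by (metis mod_eq_dvd_iff)
    then obtain s where s: "c - n = int p * s" by blast
    have "int m * n < int m * (c + 1)" using n(2) d \<open>r < m\<close> by (simp add: distrib_left)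
    then have "n < c + 1" using m by (simp add: mult_less_cancel_left_pos)
    then have "0 \<le> int p * s" using s by linarith
    then have "0 \<le> s" using p by (simp add: zero_le_mult_iff)
    have "int d - int m * n = int m * (c - n) + int r" by (simp add: d algebra_simps)
    also have "\<dots> = int (nat s * (m * p) + r)" using \<open>0 \<le> s\<close> by (simp add: s)
    finally have len: "nat (int d - int m * n) = nat s * (m * p) + r" by (simp only: nat_int)
    have "nat (int d - int m * n) > 0" using n(2) by simp
    then show ?thesis unfolding lq_length_def len using m \<open>r < m\<close> by auto
  qed
  then show "\<exists>c. \<forall>n. n mod int p = c mod int p \<longrightarrow> int m * n < int d \<longrightarrow>
      lq_length m (m * p) (nat (int d - int m * n))"
    by blast
qed

section \<open>Modulo Nim and coprimality\<close>

lemma modulo_P_if_coprime: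
  assumes "gcd m p = 1"
  shows "modulo_P m p = beatty_pairs m p"
  unfolding modulo_P_def
proof (rule lq_wythoff_P_eq)
  have "coprime p m" using assms by (simp add: coprime_iff_gcd_eq_1 gcd.commute)
  then show "p dvd t" if "lq_length 0 p (m * t)" for t
    using that by (simp add: lq_length_def coprime_dvd_mult_right_iff)
next
  fix d :: nat
  obtain u v where "u * int m + v * int p = gcd (int m) (int p)"
    using bezout_int by blast
  also have "gcd (int m) (int p) = 1" using assms by simp
  finally have uv: "u * int m + v * int p = 1" .
  \<comment> \<open>By Bezout, \<open>u\<close> inverts \<open>m\<close> modulo \<open>p\<close>, so
    \<open>n\<close> congruent to \<open>u * d\<close> makes \<open>d - m * n\<close> divisible by
    \<open>p\<close>.\<close>
  define c where "c = u * int d"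
  have "lq_length 0 p (nat (int d - int m * n))"
    if n: "n mod int p = c mod int p" "int m * n < int d" for n
  proof -
    have "int p dvd c - n" using n(1) by (metis mod_eq_dvd_iff)
    moreover have "int d - int m * n = int p * (v * int d) + int m * (c - n)"
      using arg_cong[OF uv, of "\<lambda>z. z * int d"] by (simp add: c_def algebra_simps)
    ultimately have "int p dvd int d - int m * n" by simp
    moreover have "int (nat (int d - int m * n)) = int d - int m * n" using n(2) by simp
    ultimately have "int p dvd int (nat (int d - int m * n))" by (simp only:)
    then have "p dvd nat (int d - int m * n)" by (simp only: of_nat_dvd_iff)
    then show ?thesis using n(2) by (simp add: lq_length_def)
  qed
  then show "\<exists>c. \<forall>n. n mod int p = c mod int p \<longrightarrow> int m * n < int d \<longrightarrow>
      lq_length 0 p (nat (int d - int m * n))"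
    by blast
qed

text \<open>With \<open>p' = p div gcd m p\<close>, the terminal position \<open>E 0\<close> is a \<open>p\<close>-rook move of length \<open>m * p'\<close> away from \<open>E p'\<close>.\<close>

lemma coprime_if_modulo_P:
  assumes "modulo_P m p = beatty_pairs m p"
  shows "gcd m p = 1"
proof (rule ccontr)
  assume g: "gcd m p \<noteq> 1"
  let ?opts = "\<lambda>z. {z'. bishop_move m z z' \<or> lq_rook_move 0 p z z'}"
  define p' where "p' = p div gcd m p"
  have p': "p = gcd m p * p'" by (simp add: p'_def)
  have "gcd m p \<noteq> 0" using p by simp
  then have "gcd m p > 1" using g by linarith
  have "p' > 0" using p by (simp add: p'_def div_greater_zero_iff)
  have "p' < p" using p \<open>gcd m p > 1\<close> by (simp add: p'_def)
  have "gcd m p * p' dvd m * p'" by (intro mult_dvd_mono) auto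
  then have "p dvd m * p'" by (simp only: p'[symmetric])
  have E: "E (int p') = (m * p', 0)" "E 0 = (0, 0)"
    using \<open>p' < p\<close> p by (simp_all add: E_def seq_b_eq_seq_a seq_a_eq_0)
  have "lq_rook_move 0 p (m * p', 0) (0, 0)"
    using \<open>p' > 0\<close> \<open>p dvd m * p'\<close> m by (simp add: lq_length_def)
  then have move: "E 0 \<in> ?opts (E (int p'))" unfolding E by blast
  have eq: "P_positions UNIV ?opts = range E"
    using assms by (simp only: range_E modulo_P_def lq_wythoff_P_def)
  have "E n \<in> P_positions UNIV ?opts" for n unfolding eq by (rule rangeI)
  then have "E 0 \<notin> ?opts (E (int p'))" by (intro P_positions_no_move)
  then show False using move by contradiction
qed

section \<open>Shifted games\<close>

definition E_class :: "nat \<Rightarrow> pos set" where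
  "E_class l = E ` {n. n mod int p = int l}"

lemma E_class_iff: "E n \<in> E_class l \<longleftrightarrow> n mod int p = int l"
  by (auto simp: E_class_def E_inj)

text \<open>An index congruent to \<open>l\<close> is either at least \<open>l\<close> or at most
  \<open>-(p - l)\<close>. Since \<open>b\<close> is at least \<open>m\<close> times its index, the
  larger coordinate alone already leaves the removed rectangle.\<close>

lemma E_class_board:
  assumes "l < p"
  shows "E_class l \<subseteq> shifted_board m p l"
proof
  fix z
  assume "z \<in> E_class l"
  then obtain n where n: "z = E n" "n mod int p = int l" by (auto simp: E_class_def)
  have eq: "n = int p * (n div int p) + int l" using n(2) by (metis mult_div_mod_eq)
  show "z \<in> shifted_board m p l"
  proof (cases "0 \<le> n")
    case True
    then have "0 \<le> n div int p" using p by (simp add: pos_imp_zdiv_nonneg_iff)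
    then have "0 \<le> int p * (n div int p)" by simp
    then have "int l \<le> n" using eq by linarith
    then have "m * l \<le> m * nat n" by (intro mult_le_mono2) simp
    then have "m * l \<le> seq_b m p (nat n)" unfolding seq_b_eq_seq_a by (rule trans_le_add2)
    then show ?thesis using True by (simp add: n(1) E_def shifted_board_def)
  next
    case False
    then have "n div int p \<le> - 1" using p by (simp add: pos_imp_zdiv_neg_iff flip: zle_add1_eq_le)
    then have "int p * (n div int p) \<le> int p * (- 1)" by (rule mult_left_mono) simp
    then have "int (p - l) \<le> - n" using eq assms by simp
    then have "m * (p - l) \<le> m * nat (- n)" by (intro mult_le_mono2) simp
    then have "m * (p - l) \<le> seq_b m p (nat (- n))" unfolding seq_b_eq_seq_a by (rule trans_le_add2)
    then show ?thesis using False by (simp add: n(1) E_def shifted_board_def)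
  qed
qed

lemma shifted_stable:
  assumes "z \<in> E_class l"
  shows "shifted_opts m p l z \<inter> E_class l = {}"
proof -
  have "\<not> bishop_move (m * p) z z' \<and> \<not> rook_move z z'" if "z' \<in> E_class l" for z'
    using that assms no_mp_bishop_move_E no_rook_move_E unfolding E_class_def by fastforce
  then show ?thesis by (auto simp: shifted_opts_def wythoff_opts_def)
qed

lemma move_to_class_above_diagonal:
  assumes d: "int m * int e \<le> int x - int y" and e: "int e mod int p = c mod int p"
    and notin: "\<And>n. n mod int p = c mod int p \<Longrightarrow> (x, y) \<noteq> E n"
  shows "\<exists>n. n mod int p = c mod int p \<and> E n \<in> wythoff_opts (m * p) (x, y)"
proof -
  define f where "f = int x - int y - int m * int e"
  \<comment> \<open>The largest index of the form \<open>e\<close> plus a multiple of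
    \<open>p\<close> whose diagonal does not exceed that of \<open>(x, y)\<close>; the remaining gap
    is below \<open>m * p\<close>.\<close>
  define n0 where "n0 = int e + int p * (f div int (m * p))"
  have "0 \<le> f" using d by (simp add: f_def)
  then have "0 \<le> f div int (m * p)" using mp_pos by (simp add: pos_imp_zdiv_nonneg_iff del: of_nat_mult)
  then have "0 \<le> n0" by (simp add: n0_def)
  have n0_mod: "n0 mod int p = c mod int p" using e by (simp add: n0_def)
  have "0 \<le> f mod int (m * p)" "f mod int (m * p) < int (m * p)"
    using mp_pos by (simp_all del: of_nat_mult)
  moreover have "f = int (m * p) * (f div int (m * p)) + f mod int (m * p)" by simp
  moreover have "int m * n0 = int m * int e + int (m * p) * (f div int (m * p))"
    by (simp add: n0_def distrib_left)
  ultimately have bounds: "int m * n0 \<le> int x - int y" "int x - int y < int m * n0 + int (m * p)"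
    unfolding f_def by linarith+
  obtain n where n: "n mod int p = c mod int p" "snd (E n) = y" using ex_snd_E by blast
  show ?thesis
    using rook_or_bishop_move_to_E[OF n(2) \<open>0 \<le> n0\<close> bounds notin[OF n(1)] notin[OF n0_mod]] n(1) n0_mod
    unfolding wythoff_opts_def by blast
qed

lemma shifted_absorbing:
  assumes l: "l < p" and z: "z \<in> shifted_board m p l" "z \<notin> E_class l"
  shows "shifted_opts m p l z \<inter> E_class l \<noteq> {}"
proof -
  obtain x y where xy: "z = (x, y)" by fastforce
  have l_mod: "int l mod int p = int l" using l by simp
  have notin: "(x, y) \<noteq> E n" if "n mod int p = int l mod int p" for n
    using that z(2) l_mod by (auto simp: xy E_class_iff)
  have mlp: "int (m * p) = int m * int l + int m * int (p - l)"
    using l by (simp flip: distrib_left)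
  have mpl_pos: "0 < int m * int (p - l)" using m l by simp
  have "\<exists>n. n mod int p = int l mod int p \<and> E n \<in> wythoff_opts (m * p) (x, y)"
  proof -
    \<comment> \<open>The diagonals through the two terminal positions \<open>(m * l, 0)\<close> and
      \<open>(0, m * (p - l))\<close> split the board. Outside the strip the previous lemma applies,
      on the left after reflection with \<open>p - l\<close> in place of \<open>l\<close>. The strip
      has width \<open>m * p\<close>, so from inside it a bishop move reaches whichever terminal
      position is not blocked by the edges.\<close>
    consider (right) "int m * int l \<le> int x - int y"
      | (left) "int m * int (p - l) \<le> int y - int x"
      | (middle) "int x - int y < int m * int l" "int y - int x < int m * int (p - l)"
      by linarith
    then show ?thesis
    proof cases
      case right
      then show ?thesis using move_to_class_above_diagonal[of l x y "int l"] notin by blast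
    next
      case left
      have e: "int (p - l) mod int p = (- int l) mod int p"
        using l by (simp add: mod_eq_dvd_iff)
      have minus: "(- n) mod int p = int l mod int p" if "n mod int p = (- int l) mod int p" for n
        using mod_minus_cong[OF that] by simp
      have "(y, x) \<noteq> E n" if "n mod int p = (- int l) mod int p" for n
        using notin[OF minus[OF that]] by (metis E_minus swap_simp)
      then obtain n where n: "n mod int p = (- int l) mod int p" "E n \<in> wythoff_opts (m * p) (y, x)"
        using move_to_class_above_diagonal[OF left e] by blast
      have "E (- n) \<in> wythoff_opts (m * p) (x, y)"
        using n(2) bishop_move_swap[of "m * p" "(y, x)" "E n"] rook_move_swap[of "(y, x)" "E n"]
        by (simp add: wythoff_opts_def E_minus del: bishop_move.simps rook_move.simps)
      then show ?thesis using minus[OF n(1)] by blast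
    next
      case middle
      have E_terminal: "E (int j) = (m * j, 0)" if "j < p" for j
        using that by (simp add: E_def seq_b_eq_seq_a seq_a_eq_0)
      then have El: "E (int l) = (m * l, 0)" using l by blast
      show ?thesis
      proof (cases "m * l \<le> x")
        case True
        have ne: "(x, y) \<noteq> (m * l, 0)" using notin[of "int l"] El by simp
        have "\<bar>(int x - int (m * l)) - (int y - int 0)\<bar> < int (m * p)"
          unfolding mlp using middle mpl_pos by (auto simp: abs_less_iff)
        then have "bishop_move (m * p) (x, y) (m * l, 0)"
          unfolding bishop_move.simps using True ne by simp
        then show ?thesis using El unfolding wythoff_opts_def by (intro exI[of _ "int l"]) simp
      next
        case False
        \<comment> \<open>This gives \<open>p - l < p\<close>, as \<open>E_terminal\<close> needs
          for the other terminal position; the board condition now forces \<open>y\<close> to be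
          large.\<close>
        then have "0 < l" by (cases l) auto
        have y: "m * (p - l) \<le> y" using False z(1) by (simp add: xy shifted_board_def)
        define n where "n = - int (p - l)"
        have En: "E n = (0, m * (p - l))"
          unfolding n_def E_minus using l \<open>0 < l\<close> by (subst E_terminal) simp_all
        have n_mod: "n mod int p = int l mod int p"
          using l by (simp add: n_def mod_eq_dvd_iff)
        have ne: "(x, y) \<noteq> (0, m * (p - l))" using notin[OF n_mod] En by simp
        have "0 < int m * int l" using m \<open>0 < l\<close> by simp
        then have "\<bar>(int x - int 0) - (int y - int (m * (p - l)))\<bar> < int (m * p)"
          unfolding mlp using middle by (auto simp: abs_less_iff)
        then have "bishop_move (m * p) (x, y) (0, m * (p - l))"
          unfolding bishop_move.simps using y ne by auto
        then show ?thesis using En n_mod unfolding wythoff_opts_def by (intro exI[of _ n]) simp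
      qed
    qed
  qed
  then obtain n where "n mod int p = int l" "E n \<in> wythoff_opts (m * p) z"
    using l_mod xy by auto
  then show ?thesis
    using E_class_board[OF l] E_class_iff[of n l] unfolding shifted_opts_def by blast
qed

lemma shifted_P_eq:
  assumes "l < p"
  shows "shifted_P m p l = E_class l"
  unfolding shifted_P_def
proof (rule P_positions_eq[where \<mu> = "\<lambda>z. fst z + snd z"])
  show "t \<in> shifted_board m p l \<and> fst t + snd t < fst s + snd s" if "t \<in> shifted_opts m p l s" for s t
    using that wythoff_opts_decreases unfolding shifted_opts_def by blast
qed (use assms shifted_stable shifted_absorbing E_class_board in blast)+

text \<open>Write an index of the class as \<open>k * p + l\<close>. Nonnegative \<open>k\<close>
  gives the first family, and \<open>k = -i < 0\<close> gives the index \<open>-(i * p - l)\<close>,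
  hence the second. The swap accounts for \<open>E\<close> listing the larger coordinate first at
  nonnegative indices.\<close>

lemma E_class_eq:
  assumes "l < p"
  shows "E_class l = prod.swap `
          ({(seq_a m p (i * p + l), seq_b m p (i * p + l)) | i. True}
           \<union> {(seq_b m p (i * p - l), seq_a m p (i * p - l)) | i. i \<ge> 1})"
    (is "_ = prod.swap ` (?A \<union> ?B)")
proof
  have A: "prod.swap (seq_a m p (i * p + l), seq_b m p (i * p + l)) = E (int (i * p + l))" for i
    unfolding E_def nat_int by simp
  have B: "prod.swap (seq_b m p (i * p - l), seq_a m p (i * p - l)) = E (- int (i * p - l))" for i
    unfolding E_minus by (simp add: E_def)
  show "prod.swap ` (?A \<union> ?B) \<subseteq> E_class l"
  proof
    fix z
    assume "z \<in> prod.swap ` (?A \<union> ?B)"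
    then consider i where "z = E (int (i * p + l))" | i where "i \<ge> 1" "z = E (- int (i * p - l))"
      using A B by blast
    then show "z \<in> E_class l"
    proof cases
      case 1
      then show ?thesis using assms by (simp add: E_class_iff)
    next
      case 2
      have "l \<le> i * p" using assms \<open>i \<ge> 1\<close> by (metis less_imp_le_nat mult_le_mono1 nat_mult_1 order_trans)
      then have "- int (i * p - l) = int l + int p * (- int i)" by simp
      then show ?thesis using assms 2(2) by (simp only: E_class_iff mod_mult_self2) simp
    qed
  qed
  show "E_class l \<subseteq> prod.swap ` (?A \<union> ?B)"
  proof
    fix z
    assume "z \<in> E_class l"
    then obtain n where n: "z = E n" "n mod int p = int l" by (auto simp: E_class_def)
    define k where "k = n div int p"
    have eq: "n = k * int p + int l" using n(2) by (metis k_def mod_div_decomp)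
    show "z \<in> prod.swap ` (?A \<union> ?B)"
    proof (cases "0 \<le> k")
      case True
      then have "n = int (nat k * p + l)" using eq by simp
      then have "z = prod.swap (seq_a m p (nat k * p + l), seq_b m p (nat k * p + l))"
        unfolding A n(1) by (rule arg_cong)
      then show ?thesis by blast
    next
      case False
      define i where "i = nat (- k)"
      have i: "i \<ge> 1" "int i = - k" using False by (auto simp: i_def)
      have "l \<le> i * p" using assms i(1) by (metis less_imp_le_nat mult_le_mono1 nat_mult_1 order_trans)
      then have "n = - int (i * p - l)" using eq i(2) by simp
      then have "z = prod.swap (seq_b m p (i * p - l), seq_a m p (i * p - l))"
        unfolding B n(1) by (rule arg_cong)
      then show ?thesis using i(1) by blast
    qed
  qed
qed

lemma mxp_P_eq: "mxp_P m p = beatty_pairs m p"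
proof -
  \<comment> \<open>Before the choice any pair is winning for the second player, who answers
    \<open>E n\<close> with the residue of \<open>n\<close>; a position that is no pair lies outside
    every class, so every permitted shift loses.\<close>
  define S where
    "S = {(c, z). case c of None \<Rightarrow> z \<in> range E | Some l \<Rightarrow> z \<in> E_class l}"
  define B where
    "B = {(c, z). case c of None \<Rightarrow> True | Some l \<Rightarrow> l < p \<and> z \<in> shifted_board m p l}"
  have "(prev_wins (mxp_decl m p) (mxp_moves m p) s \<longleftrightarrow> s \<in> S)
      \<and> (next_wins (mxp_decl m p) (mxp_moves m p) s \<longleftrightarrow> s \<notin> S)" if "s \<in> B" for s
  proof (rule wins_iff[where \<mu> = "\<lambda>(_, z). fst z + snd z"])
    have decl: "l < p \<and> snd s \<in> shifted_board m p l"
      if "s \<in> B" "l \<in> mxp_decl m p s" for s l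
    proof -
      obtain c z where "s = (c, z)" by (cases s)
      then show ?thesis using that by (cases c) (simp_all add: B_def)
    qed
    have moves: "mxp_moves m p s l = Pair (Some l) ` shifted_opts m p l (snd s)" for s l
      by (cases s) simp
    show "t \<in> B \<and> (case t of (_, z) \<Rightarrow> fst z + snd z) < (case s of (_, z) \<Rightarrow> fst z + snd z)"
      if s: "s \<in> B" "l \<in> mxp_decl m p s" and t: "t \<in> mxp_moves m p s l" for s l t
    proof -
      obtain z where z: "t = (Some l, z)" "z \<in> shifted_opts m p l (snd s)"
        using t unfolding moves by blast
      then show ?thesis
        using decl[OF s] wythoff_opts_decreases[of z "m * p" "snd s"]
        by (auto simp: B_def shifted_opts_def split_beta)
    qed
    have S_Some: "(Some l, z) \<in> S \<longleftrightarrow> z \<in> E_class l" for l z by (simp add: S_def)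
    show "\<exists>l\<in>mxp_decl m p s. mxp_moves m p s l \<inter> S = {}" if s: "s \<in> B" "s \<in> S" for s
    proof -
      have "\<exists>l\<in>mxp_decl m p s. snd s \<in> E_class l"
      proof (cases "fst s")
        case None
        then obtain n where n: "s = (None, E n)" using s(2) by (cases s) (auto simp: S_def)
        define l where "l = nat (n mod int p)"
        have "n mod int p = int l" "l < p" using p by (auto simp: l_def nat_less_iff)
        then have "E n \<in> E_class l" "l \<in> mxp_decl m p s"
          using E_class_board[of l] by (auto simp: n E_class_iff)
        then show ?thesis using n by auto
      next
        case (Some l)
        then show ?thesis using s(2) by (cases s) (simp add: S_def)
      qed
      then obtain l where l: "l \<in> mxp_decl m p s" "snd s \<in> E_class l" by blast
      have "mxp_moves m p s l \<inter> S = {}"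
        using shifted_stable[OF l(2)] unfolding moves by (auto simp: S_Some)
      then show ?thesis using l(1) by blast
    qed
    show "mxp_moves m p s l \<inter> S \<noteq> {}" if s: "s \<in> B" "s \<notin> S" and l: "l \<in> mxp_decl m p s" for s l
    proof -
      have "snd s \<notin> E_class l"
      proof (cases "fst s")
        case None
        then show ?thesis using s(2) by (cases s) (auto simp: S_def E_class_def)
      next
        case (Some k)
        then show ?thesis using s(2) l by (cases s) (simp add: S_def)
      qed
      then obtain z where "z \<in> shifted_opts m p l (snd s)" "z \<in> E_class l"
        using shifted_absorbing[of l "snd s"] decl[OF s(1) l] by blast
      then have "(Some l, z) \<in> mxp_moves m p s l \<inter> S"
        by (simp add: moves S_Some)
      then show ?thesis by blast
    qed
  qed (rule that)
  moreover have "(None, z) \<in> B" for z by (simp add: B_def)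
  ultimately have "prev_wins (mxp_decl m p) (mxp_moves m p) (None, z) \<longleftrightarrow> (None, z) \<in> S" for z
    by blast
  moreover have "(None, z) \<in> S \<longleftrightarrow> z \<in> range E" for z by (simp add: S_def)
  ultimately show ?thesis unfolding mxp_P_def range_E[symmetric] by simp
qed

section \<open>Blocking\<close>

lemma row_card:
  shows "finite {n. snd (E n) = y}" and "card {n. snd (E n) = y} = p"
proof -
  have "bij_betw (\<lambda>n. n mod int p) {n. snd (E n) = y} {0..<int p}"
    unfolding bij_betw_def
  proof
    show "inj_on (\<lambda>n. n mod int p) {n. snd (E n) = y}"
      using snd_E_inj_on_class by (auto simp: inj_on_def)
    show "(\<lambda>n. n mod int p) ` {n. snd (E n) = y} = {0..<int p}"
    proof
      show "{0..<int p} \<subseteq> (\<lambda>n. n mod int p) ` {n. snd (E n) = y}"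
      proof
        fix c
        assume "c \<in> {0..<int p}"
        moreover obtain n where "n mod int p = c mod int p" "snd (E n) = y"
          using ex_snd_E by blast
        ultimately show "c \<in> (\<lambda>n. n mod int p) ` {n. snd (E n) = y}" by force
      qed
    qed (use p in auto)
  qed
  then show "finite {n. snd (E n) = y}" "card {n. snd (E n) = y} = p"
    using bij_betw_finite bij_betw_same_card by fastforce+
qed

text \<open>An infinite set has \<open>card\<close> 0; finiteness makes the limit on
  \<open>card B\<close> a genuine bound on blocking sets.\<close>

lemma finite_roob_opts: "finite (roob_opts m z)"
proof (rule finite_subset)
  show "roob_opts m z \<subseteq> {..fst z} \<times> {..snd z}"
    by (cases z) (auto simp: roob_opts_def)
qed simp

lemma swap_roob_opts: "prod.swap ` roob_opts m z = roob_opts m (prod.swap z)"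
proof -
  have "t \<in> roob_opts m (prod.swap z) \<longleftrightarrow> prod.swap t \<in> roob_opts m z" for t
    using rook_move_swap[of z "prod.swap t"] bishop_move_swap[of m z "prod.swap t"]
    by (simp add: roob_opts_def)
  then show ?thesis by (metis (no_types, lifting) image_eqI image_subset_iff subsetI subset_antisym swap_swap)
qed

lemma card_roob_opts_E: "card (roob_opts m (E n) \<inter> range E) \<le> p - 1"
proof -
  have main: "card (roob_opts m (E n) \<inter> range E) \<le> p - 1" if "0 \<le> n" for n
  proof -
    let ?R = "{j. snd (E j) = snd (E n)}"
    have "roob_opts m (E n) \<inter> range E \<subseteq> E ` (?R - {n})"
    proof
      fix t
      assume "t \<in> roob_opts m (E n) \<inter> range E"
      then obtain j where j: "t = E j" "rook_move (E n) (E j)" by (auto simp: roob_opts_def)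
      obtain x y x' y' where E: "E n = (x, y)" "E j = (x', y')" by fastforce
      \<comment> \<open>For \<open>0 \<le> n\<close> there is no pair below \<open>E n\<close> in
        its column: going down increases the index, while heights do not decrease with it. So only
        the \<open>p - 1\<close> other pairs of the row remain.\<close>
      have "\<not> (x' = x \<and> y' < y)"
      proof
        assume col: "x' = x \<and> y' < y"
        then have "int m * n < int m * j" using E_diff[of n] E_diff[of j] by (simp add: E)
        then have "n \<le> j" using m by (simp add: mult_less_cancel_left_pos)
        then show False using snd_E_mono[OF \<open>0 \<le> n\<close>, of j] col by (simp add: E)
      qed
      then have "j \<in> ?R" "j \<noteq> n" using j(2) E by auto
      then show "t \<in> E ` (?R - {n})" using j(1) by blast
    qed
    then have "card (roob_opts m (E n) \<inter> range E) \<le> card (E ` (?R - {n}))"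
      using row_card(1) by (intro card_mono) auto
    also have "\<dots> \<le> card (?R - {n})" using row_card(1) by (intro card_image_le) auto
    also have "\<dots> = p - 1" by (simp add: row_card)
    finally show ?thesis .
  qed
  show ?thesis
  proof (cases "0 \<le> n")
    case False
    have "prod.swap ` range E = range E"
      using swap_in_range_E by (metis (no_types, lifting) image_eqI image_subset_iff subsetI subset_antisym swap_swap)
    then have "roob_opts m (E (- n)) \<inter> range E = prod.swap ` (roob_opts m (E n) \<inter> range E)"
      by (simp add: E_minus swap_roob_opts image_Int)
    then have "card (roob_opts m (E n) \<inter> range E) = card (roob_opts m (E (- n)) \<inter> range E)"
      by (simp add: card_image)
    then show ?thesis using main[of "- n"] False by simp
  qed (rule main)
qed

lemma blocking_P_eq: "blocking_P m p = beatty_pairs m p"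
proof -
  let ?decl = "\<lambda>z. {B. B \<subseteq> roob_opts m z \<and> card B \<le> p - 1}"
  let ?moves = "\<lambda>z B. wythoff_opts m z - B"
  have main: "?moves (x, y) B \<inter> range E \<noteq> {}"
    if "(x, y) \<notin> range E" "y \<le> x" and B: "B \<subseteq> roob_opts m (x, y)" "card B \<le> p - 1" for x y B
  proof (cases "bishop_move m (x, y) (E (int ((x - y) div m)))")
    case True
    then have "E (int ((x - y) div m)) \<in> ?moves (x, y) B"
      using B(1) by (auto simp: wythoff_opts_def roob_opts_def)
    then show ?thesis by blast
  next
    case False
    have rook: "rook_move (x, y) (E n)" if "snd (E n) = y" for n
      using rook_or_bishop_move_to_E[OF that, of "int ((x - y) div m)" x m] m_div_bounds[OF \<open>y \<le> x\<close>]
        \<open>(x, y) \<notin> range E\<close> False by auto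
    let ?R = "{n. snd (E n) = y}"
    have "card (E ` ?R) = p" by (subst card_image) (auto simp: inj_on_def E_inj row_card)
    moreover have "finite B" using B(1) finite_roob_opts finite_subset by blast
    ultimately have "\<not> E ` ?R \<subseteq> B" using B(2) p card_mono[of B "E ` ?R"] by auto
    then obtain n where "snd (E n) = y" "E n \<notin> B" by blast
    then have "E n \<in> ?moves (x, y) B" using rook by (simp add: wythoff_opts_def)
    then show ?thesis by blast
  qed
  have "prev_wins ?decl ?moves s \<longleftrightarrow> s \<in> range E" for s
  proof (rule conjunct1, rule wins_iff[where \<mu> = "\<lambda>z. fst z + snd z" and B = UNIV])
    show "t \<in> UNIV \<and> fst t + snd t < fst s + snd s" if "t \<in> ?moves s B" for s t B
      using that wythoff_opts_decreases by blast
    show "\<exists>B\<in>?decl s. ?moves s B \<inter> range E = {}" if "s \<in> range E" for s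
    proof -
      obtain n where n: "s = E n" using \<open>s \<in> range E\<close> by blast
      have "roob_opts m s \<inter> range E \<in> ?decl s" using card_roob_opts_E by (simp add: n)
      moreover have "?moves s (roob_opts m s \<inter> range E) \<inter> range E = {}"
        using no_m_bishop_move_E by (auto simp: n wythoff_opts_def roob_opts_def)
      ultimately show ?thesis by blast
    qed
    show "?moves s B \<inter> range E \<noteq> {}" if s: "s \<notin> range E" and B: "B \<in> ?decl s" for s B
    proof (cases "snd s \<le> fst s")
      case True
      then show ?thesis using main[of "fst s" "snd s" B] s B by simp
    next
      case False
      have "prod.swap ` B \<subseteq> roob_opts m (prod.swap s)" "card (prod.swap ` B) \<le> p - 1"
        using B by (auto simp: card_image simp flip: swap_roob_opts)
      then have "?moves (prod.swap s) (prod.swap ` B) \<inter> range E \<noteq> {}"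
        using main[of "snd s" "fst s" "prod.swap ` B"] False s swap_in_range_E[of s]
        by (simp add: prod.swap_def)
      then obtain t where t: "t \<in> wythoff_opts m (prod.swap s)" "t \<notin> prod.swap ` B" "t \<in> range E"
        by blast
      then have "prod.swap t \<notin> B" by (metis image_eqI swap_swap)
      moreover have "prod.swap t \<in> wythoff_opts m s"
        using t(1) bishop_move_swap[of m s "prod.swap t"] rook_move_swap[of s "prod.swap t"]
        by (simp add: wythoff_opts_def)
      ultimately show ?thesis using t(3) swap_in_range_E[of t] by blast
    qed
  qed simp
  then show ?thesis unfolding blocking_P_def range_E[symmetric] by blast
qed

end

theorem mainTheorem1:
  fixes m p :: nat
  assumes "m \<ge> 1" and "p \<ge> 1"
  shows "blocking_P m p = beatty_pairs m p
    \<and> (modulo_P m p = beatty_pairs m p \<longleftrightarrow> gcd m p = 1)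
    \<and> lq_wythoff_P m m (m * p) = beatty_pairs m p
    \<and> (\<forall>l<p. shifted_P m p l = prod.swap `
          ({(seq_a m p (i * p + l), seq_b m p (i * p + l)) | i. True}
           \<union> {(seq_b m p (i * p - l), seq_a m p (i * p - l)) | i. i \<ge> 1}))
    \<and> mxp_P m p = beatty_pairs m p"
proof -
  interpret wythoff_pairs m p using assms by unfold_locales
  have "modulo_P m p = beatty_pairs m p \<longleftrightarrow> gcd m p = 1"
    using modulo_P_if_coprime coprime_if_modulo_P by (rule iffI[rotated])
  then show ?thesis
    using blocking_P_eq lq_wythoff_P_m_mp mxp_P_eq by (simp add: shifted_P_eq E_class_eq)
qed

end
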